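(* Let $A\subset\mathbb{N}$ be a finite set, let $S_A=\{s_1,\dots,s_J\}$, $s_A$ and $\Sigma_A$ be as defined in the context, and let $s_A=\prod_{i=1}^K p_i^{n_i}$, where $p_1,\dots,p_K$ are the distinct prime divisors of $s_A$. For each $s_j\in S_A$, let $s_j=\prod_{i=1}^K p_i^{\alpha_{i,j}}$ be its prime factor decomposition. Assume that there exists an index $i\in\{1,\dots,K\}$ such that $\alpha_{i,j}\ge 1$ (so that $p_i\mid s_j$) for all $j\in\{1,\dots,J\}$. Let $E_i=|\{\alpha_{i,1},\dots,\alpha_{i,J}\}|$ be the number of distinct exponents of $p_i$ appearing among the $s_j\in S_A$. Then for any $0<\lambda_i<p_i^{-1}$ there exists a $1$-periodic set $\Gamma_A\subset\mathbb{R}$ satisfying $$\mathrm{dist}(\Gamma_A-\Gamma_A,\Sigma_A)>0\qquad\text{and}\qquad \big|[0,1]\cap\Gamma_A\big|>\lambda_i^{E_i}.$$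
   Context: $\mathbb{N}$ denotes the positive integers. $B\subset\mathbb{N}$ is a second finite set, $\min(|A|,|B|)\ge2$, and $L=|A||B|$. $A(X)=\sum_{a\in A}X^a$; $\Phi_s(X)$ is the $s$-th cyclotomic polynomial. Define $$S_A=\{s\in\mathbb{N}:\ \Phi_s(X)\mid A(X),\ \gcd(s,L)=1\},\qquad s_A=\mathrm{lcm}(S_A),$$ $$\Sigma_A=\{x\in[0,1]:\ \Phi_s(e^{2\pi i x})=0\text{ for some }s\in S_A\}.$$ Here $s_1,\dots,s_J$ enumerates the distinct elements of $S_A$. $\Gamma-\Gamma=\{x-y:\ x,y\in\Gamma\}$; $\mathrm{dist}(U,V)=\inf\{|u-v|:u\in U,v\in V\}$; $|\cdot|$ applied to a subset of $\mathbb{R}$ is Lebesgue measure (the set being understood to be measurable). A set $\Gamma\subset\mathbb{R}$ is $1$-periodic if $\Gamma+1=\Gamma$. *)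

theory Defs
  imports "HOL-Analysis.Analysis" "HOL-Computational_Algebra.Computational_Algebra"
begin

text \<open>
  The library has no cyclotomic polynomials. We take the usual complex factorization over the
  primitive \<open>s\<close>-th roots of unity. As this polynomial is monic with integer coefficients,
  divisibility of an integer polynomial by it means the same over the integers, the rationals and
  the complex numbers.
\<close>

definition cyclotomic :: "nat \<Rightarrow> complex poly" where
  "cyclotomic s = (\<Prod>k\<in>{k\<in>{1..s}. coprime k s}. [:- cis (2 * pi * real k / real s), 1:])"

definition mask_poly :: "nat set \<Rightarrow> complex poly" where
  "mask_poly A = (\<Sum>a\<in>A. monom 1 a)"

definition S_set :: "nat set \<Rightarrow> nat set \<Rightarrow> nat set" where
  "S_set A B = {s. s \<ge> 1 \<and> cyclotomic s dvd mask_poly A \<and> coprime s (card A * card B)}"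

definition s_lcm :: "nat set \<Rightarrow> nat set \<Rightarrow> nat" where
  "s_lcm A B = Lcm (S_set A B)"

definition Sigma_set :: "nat set \<Rightarrow> nat set \<Rightarrow> real set" where
  "Sigma_set A B =
     {x\<in>{0..1}. \<exists>s\<in>S_set A B. poly (cyclotomic s) (exp (2 * pi * \<i> * x)) = 0}"

definition one_periodic :: "real set \<Rightarrow> bool" where
  "one_periodic \<Gamma> \<longleftrightarrow> (\<lambda>x. x + 1) ` \<Gamma> = \<Gamma>"

definition difference_set :: "real set \<Rightarrow> real set" where
  "difference_set \<Gamma> = {x - y | x y. x \<in> \<Gamma> \<and> y \<in> \<Gamma>}"

end

theory Submission
  imports Defs
begin

text \<open>
  Write \<open>s\<^sub>A = p\<^sup>n m\<close> with \<open>p\<close> not dividing \<open>m\<close>. If \<open>x \<in> \<Sigma>\<^sub>A\<close> comes from an \<open>s\<close> that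
  contains \<open>p\<close> with exponent \<open>\<alpha> \<ge> 1\<close>, then \<open>m p\<^bsup>\<alpha>-1\<^esup> x\<close> is a fraction with exact denominator \<open>p\<close>,
  hence at distance at least \<open>1/p\<close> from the integers. So, with \<open>\<lambda> < \<mu> < 1/p\<close>, one lets \<open>\<Gamma>\<close> be the
  set of all \<open>x\<close> for which the fractional part of \<open>m p\<^bsup>\<alpha>-1\<^esup> x\<close> is less than \<open>\<mu>\<close> for each occurring
  \<open>\<alpha>\<close>. The \<open>E\<close> conditions need not be independent, but each one favours the beginning
  of its period, and therefore \<open>\<Gamma>\<close> has measure at least \<open>\<mu>\<^sup>E > \<lambda>\<^sup>E\<close>.
\<close>

section \<open>Periodic sets cut out by bounds on fractional parts, and their measure\<close>

definition frac_bounded :: "real \<Rightarrow> nat set \<Rightarrow> real set" where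
  "frac_bounded \<mu> Q = {x. \<forall>q\<in>Q. frac (real q * x) < \<mu>}"

lemma frac_bounded_insert:
  "frac_bounded \<mu> (insert b Q) = {x. frac (real b * x) < \<mu>} \<inter> frac_bounded \<mu> Q"
  by (auto simp: frac_bounded_def)

text \<open>Used with \<open>h = 1\<close> for periodicity and, in the measure bound, with
  \<open>h\<close> the reciprocal of the least frequency.\<close>

lemma frac_bounded_shift:
  assumes "\<And>q. q \<in> Q \<Longrightarrow> real q * h \<in> \<int>"
  shows "x + h \<in> frac_bounded \<mu> Q \<longleftrightarrow> x \<in> frac_bounded \<mu> Q"
proof -
  have "frac (real q * (x + h)) = frac (real q * x)" if "q \<in> Q" for q
    using assms[OF that] by (simp add: distrib_left frac_add_int_right)
  thus ?thesis by (auto simp: frac_bounded_def)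
qed

lemma one_periodic_frac_bounded: "one_periodic (frac_bounded \<mu> Q)"
  unfolding one_periodic_def
proof (intro equalityI subsetI)
  fix x assume "x \<in> (\<lambda>x. x + 1) ` frac_bounded \<mu> Q"
  thus "x \<in> frac_bounded \<mu> Q" using frac_bounded_shift[of Q 1 _ \<mu>] by auto
next
  fix x assume "x \<in> frac_bounded \<mu> Q"
  hence "x - 1 \<in> frac_bounded \<mu> Q" using frac_bounded_shift[of Q 1 "x - 1" \<mu>] by auto
  thus "x \<in> (\<lambda>x. x + 1) ` frac_bounded \<mu> Q" by (intro image_eqI[of _ _ "x - 1"]) auto
qed

lemma sets_frac_bounded:
  assumes "finite Q"
  shows "frac_bounded \<mu> Q \<in> sets borel"
proof -
  have "frac_bounded \<mu> Q = {x \<in> space borel. \<forall>q\<in>Q. real q * x - of_int \<lfloor>real q * x\<rfloor> < \<mu>}"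
    by (auto simp: frac_bounded_def frac_def)
  also have "\<dots> \<in> sets borel"
    using assms by measurable
  finally show ?thesis .
qed

lemma lmeasurable_inter_interval:
  assumes "S \<in> sets borel"
  shows "{a..<b::real} \<inter> S \<in> lmeasurable"
  by (rule bounded_set_imp_lmeasurable) (use assms in \<open>auto intro: bounded_subset[of "{a..b}"]\<close>)

text \<open>
  The bound is claimed on every initial segment \<open>[0, L)\<close>, not only on full periods, since the
  condition for \<open>b\<close> truncates each period of \<open>frac_bounded \<mu> Q\<close> to such a segment.
\<close>

lemma measure_initial_segment_ge:
  fixes \<mu> :: real
  assumes "finite Q" "\<And>q. q \<in> Q \<Longrightarrow> q > 0"
    and "\<And>q r. q \<in> Q \<Longrightarrow> r \<in> Q \<Longrightarrow> q \<le> r \<Longrightarrow> q dvd r"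
    and \<mu>: "0 < \<mu>" "\<mu> \<le> 1" and "0 \<le> L"
  shows "\<mu> ^ card Q * L \<le> measure lebesgue ({0..<L} \<inter> frac_bounded \<mu> Q)"
  using assms(1-3,6)
proof (induction Q arbitrary: L rule: finite_linorder_min_induct)
  case empty
  thus ?case by (simp add: frac_bounded_def)
next
  \<comment> \<open>The new element \<open>b\<close> is the least one. By the divisibility chain it
    divides all others, so \<open>1 / b\<close> is a common period of all the conditions.\<close>
  case (insert b Q)
  define h where "h = 1 / real b"
  define G where "G = frac_bounded \<mu> (insert b Q)"
  define c where "c = \<mu> ^ card Q"
  have c: "c > 0" using \<mu> by (simp add: c_def)
  have b: "b > 0" using insert.prems by auto
  hence h: "h > 0" by (simp add: h_def)
  have IH: "c * l \<le> measure lebesgue ({0..<l} \<inter> frac_bounded \<mu> Q)" if "l \<ge> 0" for l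
    unfolding c_def using insert.prems that by (intro insert.IH) auto
  have G: "G \<in> sets borel"
    unfolding G_def using insert.hyps by (intro sets_frac_bounded) auto
  have Q: "frac_bounded \<mu> Q \<in> sets borel"
    using insert.hyps by (intro sets_frac_bounded) auto
  have shift: "x + h \<in> G \<longleftrightarrow> x \<in> G" for x
    unfolding G_def
  proof (rule frac_bounded_shift)
    fix q assume "q \<in> insert b Q"
    hence "b dvd q" using insert.prems insert.hyps by (metis insert_iff order_less_imp_le order_refl)
    thus "real q * h \<in> \<int>" using b by (auto simp: h_def)
  qed
  \<comment> \<open>On one period \<open>[0, h)\<close> the condition for \<open>b\<close> keeps
    just \<open>[0, \<mu> * h)\<close>, so the induction hypothesis is needed on a truncated
    segment.\<close>
  have short: "c * min r (\<mu> * h) \<le> measure lebesgue ({0..<r} \<inter> G)" if r: "0 \<le> r" "r \<le> h" for r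
  proof -
    have "{0..<min r (\<mu> * h)} \<inter> frac_bounded \<mu> Q \<subseteq> {0..<r} \<inter> G"
    proof
      fix x assume x: "x \<in> {0..<min r (\<mu> * h)} \<inter> frac_bounded \<mu> Q"
      hence "real b * x < \<mu>" using b by (auto simp: h_def field_simps)
      moreover have "real b * x \<ge> 0" using x by auto
      ultimately have "frac (real b * x) = real b * x"
        using \<mu> by (simp add: frac_eq)
      thus "x \<in> {0..<r} \<inter> G"
        using x \<open>real b * x < \<mu>\<close> by (auto simp: G_def frac_bounded_insert)
    qed
    hence "measure lebesgue ({0..<min r (\<mu> * h)} \<inter> frac_bounded \<mu> Q)
      \<le> measure lebesgue ({0..<r} \<inter> G)"
      using G Q by (intro measure_mono_fmeasurable) (auto intro!: lmeasurable_inter_interval)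
    thus ?thesis using IH[of "min r (\<mu> * h)"] r h \<mu> by auto
  qed
  have step: "measure lebesgue ({0..<l} \<inter> G)
      = measure lebesgue ({0..<h} \<inter> G) + measure lebesgue ({0..<l - h} \<inter> G)" if "l \<ge> h" for l
  proof -
    have "{h..<l} \<inter> G = (+) h ` ({0..<l - h} \<inter> G)"
    proof (intro equalityI subsetI)
      fix x assume "x \<in> {h..<l} \<inter> G"
      thus "x \<in> (+) h ` ({0..<l - h} \<inter> G)"
        using shift[of "x - h"] by (intro image_eqI[of _ _ "x - h"]) auto
    qed (auto simp: shift add.commute[of h])
    hence "measure lebesgue ({h..<l} \<inter> G) = measure lebesgue ({0..<l - h} \<inter> G)"
      by (simp add: measure_translation)
    moreover have "{0..<l} \<inter> G = ({0..<h} \<inter> G) \<union> ({h..<l} \<inter> G)" using that h by auto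
    moreover have "measure lebesgue (({0..<h} \<inter> G) \<union> ({h..<l} \<inter> G))
        = measure lebesgue ({0..<h} \<inter> G) + measure lebesgue ({h..<l} \<inter> G)"
    proof -
      have "({0..<h} \<inter> G) \<inter> ({h..<l} \<inter> G) = {}" by auto
      thus ?thesis
        using measure_Un3[OF lmeasurable_inter_interval[OF G] lmeasurable_inter_interval[OF G],
          of 0 h h l] by simp
    qed
    ultimately show ?thesis by simp
  qed
  \<comment> \<open>Periods are cut off the front one at a time; \<open>N\<close> of them suffice to
    cover \<open>[0, l)\<close>.\<close>
  have "c * \<mu> * l \<le> measure lebesgue ({0..<l} \<inter> G)" if "0 \<le> l" "l \<le> real N * h" for l N
    using that
  proof (induction N arbitrary: l)
    case 0
    thus ?case by auto
  next
    case (Suc N)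
    show ?case
    proof (cases "l \<le> h")
      case True
      \<comment> \<open>An incomplete period causes no loss: as the kept part comes first, it fills
        at least the proportion \<mu> of \<open>[0, l)\<close>.\<close>
      have "\<mu> * l \<le> l" "\<mu> * l \<le> \<mu> * h"
        using \<mu> Suc.prems True by (auto simp: mult_left_le_one_le)
      hence "c * (\<mu> * l) \<le> c * min l (\<mu> * h)" using c by (intro mult_left_mono) auto
      thus ?thesis using short[of l] Suc.prems True by (simp add: mult.assoc)
    next
      case False
      have "c * \<mu> * (l - h) \<le> measure lebesgue ({0..<l - h} \<inter> G)"
        using Suc.prems False by (intro Suc.IH) (auto simp: algebra_simps)
      moreover have "c * \<mu> * h \<le> measure lebesgue ({0..<h} \<inter> G)"
        using short[of h] h \<mu> by (simp add: min_absorb2 mult.assoc mult_left_le_one_le)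
      ultimately show ?thesis using step[of l] False by (simp add: algebra_simps)
    qed
  qed
  moreover obtain N :: nat where "L / h \<le> real N" using real_arch_simple by blast
  hence "L \<le> real N * h" using h by (simp add: field_simps)
  ultimately have "c * \<mu> * L \<le> measure lebesgue ({0..<L} \<inter> G)"
    using insert.prems by blast
  moreover have "card (insert b Q) = Suc (card Q)" using insert.hyps by auto
  ultimately show ?case by (simp add: c_def G_def mult.commute)
qed

section \<open>Cyclotomic roots as reduced fractions\<close>

lemma cyclotomic_root_iff:
  "poly (cyclotomic s) z = 0 \<longleftrightarrow>
     (\<exists>k\<in>{1..s}. coprime k s \<and> z = cis (2 * pi * real k / real s))"
proof -
  have "finite {k\<in>{1..s}. coprime k s}" by simp
  thus ?thesis by (auto simp: cyclotomic_def poly_prod prod_zero_iff)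
qed

text \<open>Equal points of the unit circle have arguments that differ by \<open>n\<close> full
  turns. Adding \<open>n * s\<close> to the numerator \<open>k\<close> absorbs these and preserves
  coprimality with \<open>s\<close>.\<close>

lemma Sigma_set_fraction:
  assumes "x \<in> Sigma_set A B"
  obtains s and c :: int where "s \<in> S_set A B" "coprime c (int s)" "x = of_int c / real s"
proof -
  from assms obtain s k where s: "s \<in> S_set A B" and k: "k \<in> {1..s}" "coprime k s"
    and eq: "exp (2 * pi * \<i> * x) = cis (2 * pi * real k / real s)"
    by (auto simp: Sigma_set_def cyclotomic_root_iff)
  have "cis (2 * pi * x) = cis (2 * pi * real k / real s)"
    using eq by (simp add: cis_conv_exp mult_ac)
  then obtain n :: int where "2 * pi * x = 2 * pi * real k / real s + 2 * pi * of_int n"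
    using sin_cos_eq_iff[of "2 * pi * x" "2 * pi * real k / real s"]
    by (auto simp: complex_eq_iff mult_ac)
  hence "2 * pi * x = 2 * pi * (real k / real s + of_int n)"
    by (simp add: distrib_left)
  hence "x = real k / real s + of_int n"
    by (simp del: distrib_left_numeral)
  moreover have "s > 0" using k by auto
  ultimately have "x = of_int (int k + n * int s) / real s"
    by (simp add: field_simps)
  moreover have "coprime (int k + n * int s) (int s)"
    using k(2) gcd_add_mult[of "int s" n "int k"]
    by (simp add: coprime_iff_gcd_eq_1 gcd.commute add.commute)
  ultimately show thesis using that s by blast
qed

text \<open>\<open>setdist\<close> is 0 by convention if an argument is empty, so a positive
  distance requires a point here; \<open>1 / s\<close> is one.\<close>

lemma Sigma_set_nonempty:
  assumes "s \<in> S_set A B"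
  shows "Sigma_set A B \<noteq> {}"
proof -
  have s: "s \<ge> 1" using assms by (simp add: S_set_def)
  hence "exp (2 * pi * \<i> * (1 / real s)) = cis (2 * pi * real 1 / real s)"
    by (simp add: cis_conv_exp mult_ac)
  hence "poly (cyclotomic s) (exp (2 * pi * \<i> * (1 / real s))) = 0"
    using s unfolding cyclotomic_root_iff by (intro bexI[of _ 1]) auto
  hence "1 / real s \<in> Sigma_set A B"
    using assms s by (auto simp: Sigma_set_def)
  thus ?thesis by blast
qed

section \<open>Choice of the frequencies and the gap to \<open>Sigma_set\<close>\<close>

theorem proposition2p1:
  fixes A B :: "nat set" and p :: nat and lam :: real
  assumes "finite A" and "\<forall>a\<in>A. a \<ge> 1"
    and "finite B" and "\<forall>b\<in>B. b \<ge> 1"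
    and "min (card A) (card B) \<ge> 2"
    and "p \<in> prime_factors (s_lcm A B)"
    and "\<forall>s\<in>S_set A B. multiplicity p s \<ge> 1"
    and "0 < lam" and "lam < 1 / real p"
  shows "\<exists>\<Gamma> \<in> sets lebesgue. one_periodic \<Gamma>
    \<and> setdist (difference_set \<Gamma>) (Sigma_set A B) > 0
    \<and> measure lebesgue ({0..1} \<inter> \<Gamma>) > lam ^ card ((\<lambda>s. multiplicity p s) ` S_set A B)"
proof -
  define S where "S = S_set A B"
  define M where "M = s_lcm A B"
  define E where "E = multiplicity p ` S"
  \<comment> \<open>Membership in \<open>prime_factors\<close> excludes \<open>M = 0\<close>, the
    value of \<open>Lcm\<close> on an infinite set; hence \<open>S\<close> will be finite.\<close>
  have p: "prime p" "p dvd M" and M: "M \<noteq> 0"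
    using assms(6) by (auto simp: M_def in_prime_factors_iff)
  have dvd_M: "s dvd M" if "s \<in> S" for s
    using that by (simp add: M_def s_lcm_def S_def dvd_Lcm)
  have fin: "finite S"
    using M by (intro finite_subset[of S "{s. s dvd M}"]) (auto simp: dvd_M)
  \<comment> \<open>An empty \<open>S\<close> would give \<open>M = 1\<close>, which has no prime
    divisor.\<close>
  obtain s0 where s0: "s0 \<in> S"
    using p unfolding M_def s_lcm_def S_def by (metis Lcm_empty ex_in_conv not_prime_unit)
  have p2: "p \<ge> 2" using p(1) by (rule prime_ge_2_nat)
  obtain m where m: "M = p ^ multiplicity p M * m" "\<not> p dvd m"
    using multiplicity_decompose'[of M p] M p2 by auto
  have m0: "m > 0" using m(2) by (cases m) auto
  define q where "q = (\<lambda>\<alpha>. m * p ^ (\<alpha> - 1))"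
  have E1: "\<alpha> \<ge> 1" if "\<alpha> \<in> E" for \<alpha> using that assms(7) by (auto simp: E_def S_def)
  \<comment> \<open>Truncated subtraction would identify the exponents 0 and 1, but 0 does not occur
    in \<open>E\<close>.\<close>
  have "inj_on q E"
    using E1 m0 p2 by (auto simp: inj_on_def q_def power_inject_exp) (metis Suc_diff_1 Suc_le_eq One_nat_def)
  hence card: "card (q ` E) = card E" by (rule card_image)
  have finE: "finite E" using fin by (simp add: E_def)
  \<comment> \<open>This makes the gap below uniform over all \<open>s\<close>.\<close>
  have q_le: "q \<alpha> \<le> M" if "\<alpha> \<in> E" for \<alpha>
  proof (rule dvd_imp_le)
    from that obtain s where s: "s \<in> S" "\<alpha> = multiplicity p s" by (auto simp: E_def)
    have "\<alpha> \<le> multiplicity p M" using s dvd_M M by (auto intro: dvd_imp_multiplicity_le)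
    hence "p ^ (\<alpha> - 1) dvd p ^ multiplicity p M" by (intro le_imp_power_dvd) auto
    thus "q \<alpha> dvd M" by (subst m(1)) (auto simp: q_def mult.commute intro: mult_dvd_mono)
  qed (use M in auto)
  \<comment> \<open>\<open>\<mu> < 1 / p\<close> yields the positive distance,
    \<open>lam < \<mu>\<close> the strict measure bound.\<close>
  obtain \<mu> where \<mu>: "lam < \<mu>" "\<mu> < 1 / real p" using dense assms(9) by blast
  have "1 / real p \<le> 1" using p2 by simp
  hence \<mu>': "0 < \<mu>" "\<mu> \<le> 1" using \<mu> assms(8) by auto
  define G where "G = frac_bounded \<mu> (q ` E)"
  have G: "G \<in> sets borel" unfolding G_def using finE by (intro sets_frac_bounded) auto
  have "\<mu> ^ card (q ` E) * 1 \<le> measure lebesgue ({0..<1} \<inter> G)"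
    unfolding G_def
  proof (rule measure_initial_segment_ge)
    fix a b assume "a \<in> q ` E" "b \<in> q ` E" "a \<le> b"
    thus "a dvd b" using m0 p2
      by (auto simp: q_def intro!: le_imp_power_dvd dest: power_le_imp_le_exp[rotated])
  qed (use finE m0 p2 \<mu>' in \<open>auto simp: q_def\<close>)
  also have "\<dots> \<le> measure lebesgue ({0..1} \<inter> G)"
  proof (rule measure_mono_fmeasurable)
    show "{0..1} \<inter> G \<in> lmeasurable"
      by (rule bounded_set_imp_lmeasurable) (use G in \<open>auto intro: bounded_subset[of "{0..1}"]\<close>)
  qed (use G in auto)
  finally have "\<mu> ^ card E \<le> measure lebesgue ({0..1} \<inter> G)" by (simp add: card)
  moreover have "card E > 0" using s0 finE by (auto simp: E_def card_gt_0_iff)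
  hence "lam ^ card E < \<mu> ^ card E" using \<mu> assms(8) by (intro power_strict_mono) auto
  ultimately have meas: "lam ^ card E < measure lebesgue ({0..1} \<inter> G)" by simp

  \<comment> \<open>Scaled by \<open>q \<alpha>\<close>, \<open>u\<close> comes within \<mu> of an
    integer \<open>N\<close>, while \<open>x\<close> becomes a fraction with exact denominator
    \<open>p\<close>, at distance at least \<open>1 / p\<close> from \<open>N\<close>.\<close>
  have gap: "(1 / real p - \<mu>) / real M \<le> dist u x"
    if u: "u \<in> difference_set G" and x: "x \<in> Sigma_set A B" for u x
  proof -
    obtain s c where s: "s \<in> S" and c: "coprime c (int s)" and xeq: "x = of_int c / real s"
      using Sigma_set_fraction[OF x] unfolding S_def by blast
    define \<alpha> where "\<alpha> = multiplicity p s"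
    have \<alpha>: "\<alpha> \<in> E" "\<alpha> \<ge> 1" using s E1 by (auto simp: \<alpha>_def E_def)
    have s_pos: "s > 0" using s by (auto simp: S_def S_set_def)
    obtain t where t: "s = p ^ \<alpha> * t" "\<not> p dvd t"
      using multiplicity_decompose'[of s p] s_pos p2 by (auto simp: \<alpha>_def)
    \<comment> \<open>The part of \<open>s\<close> prime to \<open>p\<close> divides that of
      \<open>M\<close>, so multiplication by \<open>q \<alpha>\<close> cancels all of
      \<open>s\<close> but one factor \<open>p\<close>.\<close>
    have "t dvd p ^ multiplicity p M * m" using dvd_M[OF s] t m(1) by (metis dvd_mult_right)
    moreover have "coprime t (p ^ multiplicity p M)"
      using t(2) p(1) by (metis coprime_commute coprime_power_right_iff prime_imp_coprime)
    ultimately have "t dvd m" by (simp add: coprime_dvd_mult_right_iff)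
    then obtain r where r: "m = t * r" by blast
    have ps: "p dvd s" using t \<alpha> by (simp add: dvd_power)
    have "\<not> int p dvd c"
    proof
      assume "int p dvd c"
      hence "is_unit (int p)" using c ps by (meson coprime_common_divisor int_dvd_int_iff)
      thus False using p2 by simp
    qed
    moreover have "\<not> int p dvd int r" using m(2) r by (auto simp: int_dvd_int_iff)
    ultimately have ncr: "\<not> int p dvd c * int r"
      using p(1) by (simp add: prime_dvd_mult_iff)
    have qx: "real (q \<alpha>) * x = of_int (c * int r) / real p"
    proof -
      have "p ^ \<alpha> = p * p ^ (\<alpha> - 1)" using \<alpha>(2) by (cases \<alpha>) auto
      moreover have "t > 0" using t(2) by (cases t) auto
      ultimately show ?thesis using p2 by (simp add: xeq t(1) q_def r field_simps)
    qed
    obtain y z where yz: "u = y - z" "y \<in> G" "z \<in> G"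
      using u by (auto simp: difference_set_def)
    have fr: "frac (real (q \<alpha>) * y) < \<mu>" "frac (real (q \<alpha>) * z) < \<mu>"
      using yz \<alpha>(1) by (auto simp: G_def frac_bounded_def)
    define N where "N = \<lfloor>real (q \<alpha>) * y\<rfloor> - \<lfloor>real (q \<alpha>) * z\<rfloor>"
    define \<delta> where "\<delta> = frac (real (q \<alpha>) * y) - frac (real (q \<alpha>) * z)"
    have \<delta>: "\<bar>\<delta>\<bar> < \<mu>"
      using fr frac_ge_0[of "real (q \<alpha>) * y"] frac_ge_0[of "real (q \<alpha>) * z"]
      unfolding \<delta>_def by linarith
    have qu: "real (q \<alpha>) * u = of_int N + \<delta>"
      by (simp add: yz N_def \<delta>_def frac_def algebra_simps)
    have "c * int r - int p * N \<noteq> 0" using ncr by auto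
    hence "1 \<le> \<bar>c * int r - int p * N\<bar>" by linarith
    hence "1 \<le> \<bar>of_int (c * int r - int p * N) :: real\<bar>" by linarith
    hence "1 / real p \<le> \<bar>of_int (c * int r - int p * N) / real p\<bar>"
      using p2 by (simp add: divide_right_mono)
    also have "of_int (c * int r - int p * N) / real p = real (q \<alpha>) * x - of_int N"
      unfolding qx using p2 by (simp add: diff_divide_distrib)
    finally have "1 / real p - \<mu> \<le> \<bar>real (q \<alpha>) * u - real (q \<alpha>) * x\<bar>"
      using \<delta> qu by linarith
    also have "\<dots> = real (q \<alpha>) * dist u x"
      by (simp add: dist_real_def abs_mult flip: right_diff_distrib)
    also have "\<dots> \<le> real M * dist u x"
      using q_le[OF \<alpha>(1)] by (intro mult_right_mono) auto
    finally show ?thesis using M by (simp add: field_simps)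
  qed
  have "0 \<in> G" using \<mu>' by (simp add: G_def frac_bounded_def)
  hence "difference_set G \<noteq> {}" by (auto simp: difference_set_def)
  moreover have "Sigma_set A B \<noteq> {}" using Sigma_set_nonempty s0 by (simp add: S_def)
  ultimately have "(1 / real p - \<mu>) / real M \<le> setdist (difference_set G) (Sigma_set A B)"
    using gap by (intro le_setdistI) auto
  moreover have "0 < (1 / real p - \<mu>) / real M" using \<mu> M by simp
  ultimately have "setdist (difference_set G) (Sigma_set A B) > 0" by linarith
  thus ?thesis
    using meas G one_periodic_frac_bounded[of \<mu> "q ` E"]
    by (intro bexI[of _ G]) (auto simp: G_def E_def S_def)
qed

end
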